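(* Let $X$ be an arbitrary bounded metric space, let $\lambda>0$ be a real number, and let $\lambda\Delta$ be a simplex all of whose non-zero distances equal $\lambda$, of cardinality $m=\#\lambda\Delta\le\#X$. Suppose that $\operatorname{diam}X-\alpha_m^-(X)\le 2d_m(X)$. Then: (1) if $\lambda\le\alpha_m^-(X)+d_m(X)$, then $$2d_{GH}(\lambda\Delta,X)=\max\{\operatorname{diam}X-\lambda,\ d_m(X)\};$$ (2) if $\alpha_m^-(X)+d_m(X)\le\lambda\le\alpha_m(X)+d_m^+(X)$, then $$\max\{\lambda-\alpha_m(X),\ d_m(X)\}\le 2d_{GH}(\lambda\Delta,X)\le\min\{\lambda-\alpha_m^-(X),\ d_m^+(X)\};$$ (3) if $\lambda\ge\alpha_m(X)+d_m^+(X)$, then $$2d_{GH}(\lambda\Delta,X)=\lambda-\alpha_m(X).$$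
   Context: Metric spaces are assumed non-empty. $\#X$ denotes the cardinality of $X$; $|xy|$ denotes the distance between points $x,y$. A simplex is a metric space all of whose non-zero distances are equal; $\lambda\Delta$ denotes a simplex whose non-zero distances all equal $\lambda>0$ (its cardinality may be any finite or infinite non-zero cardinal). For metric spaces $X,Y$, the Gromov--Hausdorff distance $d_{GH}(X,Y)$ is the infimum of real numbers $r$ for which there exist a metric space $Z$ and subsets $X',Y'\subset Z$ isometric to $X$ and $Y$, respectively, such that $d_H(X',Y')\le r$, where $d_H$ is the Hausdorff distance in $Z$. For a cardinal number $m\le\#X$ let $\mathcal{D}_m(X)$ be the set of all partitions of $X$ into $m$ non-empty subsets. For $D=\{X_i\}_{i\in I}\in\mathcal{D}_m(X)$ put $\operatorname{diam}D=\sup_{i\in I}\operatorname{diam}X_i$ and $\alpha(D)=\inf\{|X_iX_j| : i\ne j\}$, where $|AB|=\inf\{|ab| : a\in A,\ b\in B\}$ for non-empty $A,B\subset X$; for $m=1$ the infimum over the empty set is $\alpha(D)=+\infty$, and expressions are read in the extended reals. Put $$\alpha_m^-(X)=\inf_{D\in\mathcal{D}_m(X)}\alpha(D),\qquad \alpha_m(X)=\sup_{D\in\mathcal{D}_m(X)}\alpha(D),$$ $$d_m(X)=\inf_{D\in\mathcal{D}_m(X)}\operatorname{diam}D,\qquad d_m^+(X)=\sup_{D\in\mathcal{D}_m(X)}\operatorname{diam}D.$$ *)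

theory Defs
  imports "HOL-Analysis.Analysis" "HOL-Library.Equipollence" "HOL-Library.Disjoint_Sets"
begin

text \<open>
  Metric spaces are nonempty subsets of a type of class \<^class>\<open>metric_space\<close>. All quantities
  that can become infinite are taken in \<^typ>\<open>ereal\<close>.
\<close>

definition is_simplex :: "real \<Rightarrow> 'a::metric_space set \<Rightarrow> bool" where
  "is_simplex l S \<longleftrightarrow> S \<noteq> {} \<and> (\<forall>x\<in>S. \<forall>y\<in>S. x \<noteq> y \<longrightarrow> dist x y = l)"

definition hausdorff_dist :: "'c metric \<Rightarrow> 'c set \<Rightarrow> 'c set \<Rightarrow> ereal" where
  "hausdorff_dist Z A B =
     max (SUP a\<in>A. INF b\<in>B. ereal (mdist Z a b)) (SUP b\<in>B. INF a\<in>A. ereal (mdist Z a b))"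

definition isometric_copy :: "'c metric \<Rightarrow> 'c set \<Rightarrow> 'a::metric_space set \<Rightarrow> bool" where
  "isometric_copy Z A X \<longleftrightarrow> A \<subseteq> mspace Z \<and>
     (\<exists>f. bij_betw f X A \<and> (\<forall>x\<in>X. \<forall>y\<in>X. mdist Z (f x) (f y) = dist x y))"

definition gh_realized ::
    "'c metric \<Rightarrow> 'a::metric_space set \<Rightarrow> 'b::metric_space set \<Rightarrow> real \<Rightarrow> bool" where
  "gh_realized Z X Y r \<longleftrightarrow>
     (\<exists>X' Y'. isometric_copy Z X' X \<and> isometric_copy Z Y' Y \<and> hausdorff_dist Z X' Y' \<le> ereal r)"

text \<open>
  One cannot quantify over types, so the ambient spaces range over all metric spaces whose
  carrier is a subset of \<^typ>\<open>'a + 'b\<close>. This is no restriction: an ambient space may be replaced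
  by its subspace formed by the two copies, which fits into the sum type; see
  \<open>gh_realized_sum_type\<close> below.
\<close>

definition gh_dist :: "'a::metric_space set \<Rightarrow> 'b::metric_space set \<Rightarrow> ereal" where
  "gh_dist X Y = Inf {ereal r | r. \<exists>Z :: ('a + 'b) metric. gh_realized Z X Y r}"

lemma gh_realized_sum_type:
  fixes Z :: "'c metric" and X :: "'a::metric_space set" and Y :: "'b::metric_space set"
  assumes "gh_realized Z X Y r"
  shows "\<exists>Z' :: ('a + 'b) metric. gh_realized Z' X Y r"
proof -
  obtain A B f g where A: "A \<subseteq> mspace Z" "bij_betw f X A"
      "\<And>x y. x \<in> X \<Longrightarrow> y \<in> X \<Longrightarrow> mdist Z (f x) (f y) = dist x y"
    and B: "B \<subseteq> mspace Z" "bij_betw g Y B"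
      "\<And>x y. x \<in> Y \<Longrightarrow> y \<in> Y \<Longrightarrow> mdist Z (g x) (g y) = dist x y"
    and H: "hausdorff_dist Z A B \<le> ereal r"
    using assms unfolding gh_realized_def isometric_copy_def by blast
  define h :: "'c \<Rightarrow> 'a + 'b"
    where "h z = (if z \<in> A then Inl (inv_into X f z) else Inr (inv_into Y g z))" for z
  have inj: "inj_on h (A \<union> B)"
  proof (rule inj_onI)
    fix u v assume "u \<in> A \<union> B" "v \<in> A \<union> B" "h u = h v"
    then show "u = v"
      using A(2) B(2) unfolding h_def bij_betw_def
      by (auto split: if_splits dest: inv_into_injective)
  qed
  define k where "k = inv_into (A \<union> B) h"
  have kh [simp]: "k (h z) = z" if "z \<in> A \<union> B" for z
    using inj that by (simp add: k_def)
  define M where "M = h ` (A \<union> B)"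
  have sub: "A \<union> B \<subseteq> mspace Z" using A(1) B(1) by blast
  have "Metric_space M (\<lambda>u v. mdist Z (k u) (k v))"
    unfolding M_def
  proof (unfold_locales, goal_cases)
    case (1 u v) then show ?case by simp
  next
    case (2 u v) then show ?case by (simp add: mdist_commute)
  next
    case (3 u v) then show ?case using sub by (auto simp: subset_iff)
  next
    case (4 u v w) then show ?case using sub by (auto simp: subset_iff intro!: mdist_triangle)
  qed
  define Z' where "Z' = metric (M, \<lambda>u v. mdist Z (k u) (k v))"
  have ms: "mspace Z' = M" and md: "mdist Z' = (\<lambda>u v. mdist Z (k u) (k v))"
    using \<open>Metric_space M _\<close> unfolding Z'_def
    by (simp_all add: Metric_space.mspace_metric Metric_space.mdist_metric)
  have hA: "bij_betw h A (h ` A)" and hB: "bij_betw h B (h ` B)"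
    using inj by (auto simp: bij_betw_def intro: inj_on_subset)
  have fA: "f x \<in> A" if "x \<in> X" for x using A(2) that by (auto simp: bij_betw_def)
  have gB: "g x \<in> B" if "x \<in> Y" for x using B(2) that by (auto simp: bij_betw_def)
  have "isometric_copy Z' (h ` A) X"
    unfolding isometric_copy_def
    by (intro conjI exI[of _ "h \<circ> f"]) (auto simp: ms md M_def fA A(3) intro: bij_betw_trans[OF A(2) hA])
  moreover have "isometric_copy Z' (h ` B) Y"
    unfolding isometric_copy_def
    by (intro conjI exI[of _ "h \<circ> g"]) (auto simp: ms md M_def gB B(3) intro: bij_betw_trans[OF B(2) hB])
  moreover have "hausdorff_dist Z' (h ` A) (h ` B) = hausdorff_dist Z A B"
    unfolding hausdorff_dist_def md image_image by (simp cong: SUP_cong INF_cong)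
  ultimately show ?thesis
    using H unfolding gh_realized_def by metis
qed

text \<open>
  A cardinal \<open>m\<close> is represented by a set \<open>M\<close> of cardinality \<open>m\<close>; every definition below
  depends on \<open>M\<close> only through its cardinality. The library's real-valued \<^const>\<open>diameter\<close> is
  the supremum of distances only on bounded sets, so the definitions are meant for bounded \<open>X\<close>.
\<close>

definition partitions_card :: "'b set \<Rightarrow> 'a set \<Rightarrow> 'a set set set" where
  "partitions_card M X = {D. partition_on X D \<and> D \<approx> M}"

definition diam_part :: "'a::metric_space set set \<Rightarrow> ereal" where
  "diam_part D = (SUP A\<in>D. ereal (diameter A))"

text \<open>For a one-element partition the infimum is over the empty set, i.e. \<open>\<infinity>\<close>.\<close>

definition alpha_part :: "'a::metric_space set set \<Rightarrow> ereal" where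
  "alpha_part D = Inf {ereal (setdist A B) | A B. A \<in> D \<and> B \<in> D \<and> A \<noteq> B}"

definition alpha_minus :: "'b set \<Rightarrow> 'a::metric_space set \<Rightarrow> ereal" where
  "alpha_minus M X = (INF D\<in>partitions_card M X. alpha_part D)"

definition alpha_plus :: "'b set \<Rightarrow> 'a::metric_space set \<Rightarrow> ereal" where
  "alpha_plus M X = (SUP D\<in>partitions_card M X. alpha_part D)"

definition d_minus :: "'b set \<Rightarrow> 'a::metric_space set \<Rightarrow> ereal" where
  "d_minus M X = (INF D\<in>partitions_card M X. diam_part D)"

definition d_plus :: "'b set \<Rightarrow> 'a::metric_space set \<Rightarrow> ereal" where
  "d_plus M X = (SUP D\<in>partitions_card M X. diam_part D)"

end

theory Submission
  imports Defs
begin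

text \<open>
  Everything follows from one formula, \<open>gh_dist_simplex\<close>: twice the distance from \<open>X\<close> to a simplex
  of cardinality \<open>m\<close> and edge length \<open>l\<close> is the infimum, over the partitions \<open>D\<close> of \<open>X\<close> into \<open>m\<close>
  parts, of the largest of \<open>diam D\<close>, \<open>l - \<alpha>(D)\<close> and \<open>diam X - l\<close>. Such a partition is the same as a
  surjection from \<open>X\<close> onto the simplex, and the three terms bound how far that surjection distorts
  distances: inside a part, where \<open>0\<close> replaces the distance, and between two parts, where \<open>l\<close>
  replaces a distance that is too small or too large.

  For the upper bound (\<open>gh_realized_labelling\<close>) a surjection is turned into a metric on the
  disjoint union. For the lower bound (\<open>labelling_of_gh_realized\<close>) the simplex and \<open>X\<close> lie at
  Hausdorff distance less than \<open>r\<close> in a common space. If \<open>2r \<le> l\<close>, a point of \<open>X\<close> cannot be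
  \<open>r\<close>-close to two vertices, so closeness is a surjection. If \<open>2r > l\<close>, the lower
  bound on distances between parts is void; then any choice of a close vertex gives a
  partition into at most \<open>m\<close> parts of small diameter, and splitting parts until there are exactly \<open>m\<close>
  of them (\<open>refine_to_surjective_labelling\<close>, possible since \<open>m \<le> #X\<close>) does no harm.

  In the corollary it remains to see which of the three terms dominate. If
  \<open>l \<le> \<alpha>\<^sub>m\<^sup>- + d\<^sub>m\<close>, then \<open>l - \<alpha>(D) \<le> d\<^sub>m \<le> diam D\<close>, so the middle term drops out. If
  \<open>l \<ge> \<alpha>\<^sub>m\<^sup>- + d\<^sub>m\<close>, the hypothesis gives \<open>diam X - l \<le> d\<^sub>m \<le> diam D\<close>, so the last term drops
  out, and the rest is bounded by taking extrema of the two remaining terms separately. If even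
  \<open>l \<ge> \<alpha>\<^sub>m + d\<^sub>m\<^sup>+\<close>, then \<open>diam D \<le> l - \<alpha>(D)\<close> as well, and only \<open>l - \<alpha>(D)\<close> is left.
\<close>

section \<open>Partitions as labellings\<close>

definition fibres :: "('a \<Rightarrow> 'b) \<Rightarrow> 'b set \<Rightarrow> 'a set \<Rightarrow> 'a set set" where
  "fibres \<phi> M X = (\<lambda>s. {x \<in> X. \<phi> x = s}) ` M"

text \<open>
  Composing the map that sends a point to its part with a bijection from the parts to \<open>M\<close> makes a
  partition the fibres of a surjection onto \<open>M\<close>. Surjections are easier to
  build than partitions of a prescribed cardinality.
\<close>

lemma partitions_card_eq_fibres:
  "partitions_card M X = {fibres \<phi> M X | \<phi>. \<phi> ` X = M}"
proof (intro set_eqI iffI)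
  fix D assume "D \<in> partitions_card M X"
  then have part: "partition_on X D" and "D \<approx> M"
    by (auto simp: partitions_card_def)
  then obtain b where b: "bij_betw b D M"
    by (auto simp: eqpoll_def)
  define cell where "cell x = (SOME A. A \<in> D \<and> x \<in> A)" for x
  have cell: "cell x = A" if "A \<in> D" "x \<in> A" for x A
  proof -
    have "cell x \<in> D \<and> x \<in> cell x"
      unfolding cell_def using that by (rule_tac someI[of _ A]) auto
    then show ?thesis
      using that partition_onD2[OF part] by (auto simp: disjoint_def)
  qed
  have X: "X = \<Union>D" and ne: "{} \<notin> D"
    using part partition_onD1 partition_onD3 by blast+
  define \<phi> where "\<phi> x = b (cell x)" for x
  have fibre: "{x \<in> X. \<phi> x = b A} = A" if "A \<in> D" for A
  proof -
    have "b (cell x) = b A \<longleftrightarrow> x \<in> A" if "x \<in> X" for x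
      using that X cell \<open>A \<in> D\<close> b unfolding bij_betw_def
      by (metis UnionE inj_onD)
    then show ?thesis using that X by (auto simp: \<phi>_def)
  qed
  have bD: "b ` D = M" using b by (simp add: bij_betw_def)
  have "\<phi> ` X = b ` D"
  proof
    show "\<phi> ` X \<subseteq> b ` D" using X cell by (auto simp: \<phi>_def)
    show "b ` D \<subseteq> \<phi> ` X"
    proof
      fix t assume "t \<in> b ` D"
      then obtain A where A: "A \<in> D" "t = b A" by auto
      then obtain x where "x \<in> A" using ne by (metis ex_in_conv)
      then have "x \<in> X" "\<phi> x = t" using A fibre[of A] by auto
      then show "t \<in> \<phi> ` X" by auto
    qed
  qed
  moreover have "fibres \<phi> M X = D"
    unfolding fibres_def bD[symmetric] image_image using fibre by simp
  ultimately show "D \<in> {fibres \<phi> M X | \<phi>. \<phi> ` X = M}"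
    using bD by auto
next
  fix D assume "D \<in> {fibres \<phi> M X | \<phi>. \<phi> ` X = M}"
  then obtain \<phi> where \<phi>: "\<phi> ` X = M" and D: "D = fibres \<phi> M X" by auto
  have "partition_on X D"
    unfolding D fibres_def using \<phi> by (intro partition_onI) (auto simp: disjnt_def)
  moreover have "inj_on (\<lambda>s. {x \<in> X. \<phi> x = s}) M"
    using \<phi> by (intro inj_onI) blast
  then have "D \<approx> M"
    unfolding D fibres_def by (rule inj_on_image_eqpoll_self)
  ultimately show "D \<in> partitions_card M X"
    by (simp add: partitions_card_def)
qed

text \<open>
  An injection of \<open>S\<close> into \<open>X\<close> supplies the extra points. For infinite \<open>S\<close> all of its image can be
  added, since the union of two sets of cardinality at most \<open>#S\<close> is no larger than \<open>S\<close>; for finite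
  \<open>S\<close> the right number of points is selected from the union.
\<close>

lemma subset_extend_eqpoll:
  assumes "T \<subseteq> X" "T \<lesssim> S" "S \<lesssim> X"
  shows "\<exists>U. T \<subseteq> U \<and> U \<subseteq> X \<and> U \<approx> S"
proof -
  obtain g where g: "inj_on g S" "g ` S \<subseteq> X"
    using assms(3) by (auto simp: lepoll_def)
  have gS: "g ` S \<approx> S" using g(1) by (rule inj_on_image_eqpoll_self)
  show ?thesis
  proof (cases "finite S")
    case True
    then have "finite T" "card T \<le> card S"
      using assms(2) by (auto simp: lepoll_def card_inj_on_le intro: inj_on_finite)
    moreover have "card S \<le> card (T \<union> g ` S)"
      using True \<open>finite T\<close> card_mono[of "T \<union> g ` S" "g ` S"] card_image[OF g(1)] by simp
    ultimately obtain U where U: "T \<subseteq> U" "U \<subseteq> T \<union> g ` S" "card U = card S"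
      using exists_subset_between[of T "card S" "T \<union> g ` S"] True by auto
    then have "U \<approx> S"
      using True \<open>finite T\<close> by (simp add: eqpoll_iff_card finite_subset)
    then show ?thesis using U assms(1) g(2) by blast
  next
    case False
    have "T \<union> g ` S \<lesssim> S"
      using assms(2) g(1) False card_of_Un_ordLeq_infinite_Field[of "card_of S" T "g ` S", OF _ _ _ card_of_Card_order]
        eqpoll_imp_lepoll[OF gS]
      by (simp add: lepoll_def card_of_ordLeq Field_card_of)
    moreover have "S \<lesssim> T \<union> g ` S"
      using gS by (meson eqpoll_sym lepoll_trans1 subset_imp_lepoll sup_ge2)
    ultimately have "T \<union> g ` S \<approx> S" by (rule lepoll_antisym)
    then show ?thesis using assms(1) g(2) by blast
  qed
qed

text \<open>
  Choose one representative in every fibre of \<open>\<psi>\<close> and extend the set of representatives to a subset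
  \<open>T\<close> of \<open>X\<close> with \<open>T \<approx> S\<close>. Every point of \<open>T\<close> becomes a part of its own, and every other point joins the
  representative of its fibre. Hence the new fibres refine the old ones and are indexed by \<open>T\<close>.
\<close>

lemma refine_to_surjective_labelling:
  assumes "\<psi> ` X \<subseteq> S" "S \<lesssim> X"
  obtains \<phi> where "\<phi> ` X = S" "\<And>x y. x \<in> X \<Longrightarrow> y \<in> X \<Longrightarrow> \<phi> x = \<phi> y \<Longrightarrow> \<psi> x = \<psi> y"
proof -
  define rep where "rep = inv_into X \<psi>"
  have rep: "rep (\<psi> x) \<in> X" "\<psi> (rep (\<psi> x)) = \<psi> x" if "x \<in> X" for x
    using that by (auto simp: rep_def inv_into_into f_inv_into_f)
  have "rep ` \<psi> ` X \<lesssim> S"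
    using assms(1) by (meson image_lepoll lepoll_trans subset_imp_lepoll)
  moreover have "rep ` \<psi> ` X \<subseteq> X" using rep by auto
  ultimately obtain T where T: "rep ` \<psi> ` X \<subseteq> T" "T \<subseteq> X" "T \<approx> S"
    using subset_extend_eqpoll assms(2) by metis
  then obtain b where b: "bij_betw b T S" by (auto simp: eqpoll_def)
  define rt where "rt x = (if x \<in> T then x else rep (\<psi> x))" for x
  have rt: "rt x \<in> T" "\<psi> (rt x) = \<psi> x" if "x \<in> X" for x
    using that T rep by (auto simp: rt_def)
  have "rt ` X = T" using rt T(2) by (force simp: rt_def)
  then have "(b \<circ> rt) ` X = S" using b by (metis bij_betw_def image_comp)
  moreover have "\<psi> x = \<psi> y" if "x \<in> X" "y \<in> X" "(b \<circ> rt) x = (b \<circ> rt) y" for x y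
    using that rt b unfolding bij_betw_def comp_def by (metis inj_onD)
  ultimately show thesis by (rule that)
qed

section \<open>The distortion of a partition\<close>

text \<open>
  For \<open>l > 0\<close> this is the distortion, in the sense of correspondences, of the map from \<open>X\<close> to the
  simplex with edge \<open>l\<close> whose fibres are the parts. The last term may use all pairs of points rather
  than those in different parts, because \<open>dist x y - l \<le> diam D\<close> inside a part.
\<close>

definition partition_distortion :: "real \<Rightarrow> 'a::metric_space set \<Rightarrow> 'a set set \<Rightarrow> ereal" where
  "partition_distortion l X D =
     max (diam_part D) (max (ereal l - alpha_part D) (ereal (diameter X) - ereal l))"

lemma diameter_le_iff:
  assumes "bounded X" "X \<noteq> {}"
  shows "diameter X \<le> c \<longleftrightarrow> (\<forall>x\<in>X. \<forall>y\<in>X. dist x y \<le> c)"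
proof
  assume "diameter X \<le> c"
  then show "\<forall>x\<in>X. \<forall>y\<in>X. dist x y \<le> c"
    using diameter_bounded_bound[OF assms(1)] by (meson order_trans)
next
  assume "\<forall>x\<in>X. \<forall>y\<in>X. dist x y \<le> c"
  then show "diameter X \<le> c"
    using assms(2) by (auto simp: diameter_def intro!: cSUP_least)
qed

lemma diam_part_fibres_le_iff:
  assumes "bounded X" "\<phi> ` X = M"
  shows "diam_part (fibres \<phi> M X) \<le> ereal c \<longleftrightarrow>
    (\<forall>x\<in>X. \<forall>y\<in>X. \<phi> x = \<phi> y \<longrightarrow> dist x y \<le> c)"
proof -
  have "diameter {x \<in> X. \<phi> x = s} \<le> c \<longleftrightarrow>
      (\<forall>x\<in>{x \<in> X. \<phi> x = s}. \<forall>y\<in>{x \<in> X. \<phi> x = s}. dist x y \<le> c)" if "s \<in> M" for s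
    using that assms by (intro diameter_le_iff) (auto intro: bounded_subset)
  then show ?thesis
    using assms(2) unfolding diam_part_def fibres_def by (auto simp: SUP_le_iff)
qed

lemma alpha_part_fibres_ge_iff:
  fixes X :: "'a::metric_space set"
  assumes "\<phi> ` X = M"
  shows "ereal c \<le> alpha_part (fibres \<phi> M X) \<longleftrightarrow>
    (\<forall>x\<in>X. \<forall>y\<in>X. \<phi> x \<noteq> \<phi> y \<longrightarrow> c \<le> dist x y)"
proof -
  have ne: "{x \<in> X. \<phi> x = s} \<noteq> {}" if "s \<in> M" for s using that assms by auto
  have distinct: "{x \<in> X. \<phi> x = s} \<noteq> {x \<in> X. \<phi> x = t} \<longleftrightarrow> s \<noteq> t" if "s \<in> M" for s t
    using ne[OF that] by blast
  have "ereal c \<le> alpha_part D \<longleftrightarrow> (\<forall>A\<in>D. \<forall>B\<in>D. A \<noteq> B \<longrightarrow> c \<le> setdist A B)"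
    for D :: "'a set set"
    unfolding alpha_part_def le_Inf_iff by fastforce
  then have "ereal c \<le> alpha_part (fibres \<phi> M X) \<longleftrightarrow>
    (\<forall>s\<in>M. \<forall>t\<in>M. {x \<in> X. \<phi> x = s} \<noteq> {x \<in> X. \<phi> x = t} \<longrightarrow>
       c \<le> setdist {x \<in> X. \<phi> x = s} {x \<in> X. \<phi> x = t})"
    by (simp add: fibres_def)
  also have "\<dots> \<longleftrightarrow> (\<forall>s\<in>M. \<forall>t\<in>M. s \<noteq> t \<longrightarrow>
       c \<le> setdist {x \<in> X. \<phi> x = s} {x \<in> X. \<phi> x = t})"
    using distinct by simp
  also have "\<dots> \<longleftrightarrow> (\<forall>x\<in>X. \<forall>y\<in>X. \<phi> x \<noteq> \<phi> y \<longrightarrow> c \<le> dist x y)"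
    unfolding le_setdist_iff using ne assms by simp blast
  finally show ?thesis .
qed

lemma ereal_minus_le_swap: "ereal l - a \<le> ereal c \<longleftrightarrow> ereal (l - c) \<le> a"
  by (cases a) auto

text \<open>
  This pointwise form is the interface between the extended real quantities of a partition and the
  metric constructions, which only see pairs of points.
\<close>

lemma partition_distortion_fibres_le_iff:
  assumes "bounded X" "X \<noteq> {}" "\<phi> ` X = M"
  shows "partition_distortion l X (fibres \<phi> M X) \<le> ereal c \<longleftrightarrow>
    (\<forall>x\<in>X. \<forall>y\<in>X. (\<phi> x = \<phi> y \<longrightarrow> dist x y \<le> c) \<and> (\<phi> x \<noteq> \<phi> y \<longrightarrow> l - c \<le> dist x y)
       \<and> dist x y \<le> l + c)"
proof -
  have "ereal (diameter X) - ereal l \<le> ereal c \<longleftrightarrow> (\<forall>x\<in>X. \<forall>y\<in>X. dist x y \<le> l + c)"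
    using diameter_le_iff[OF assms(1,2), of "l + c"] by auto
  then show ?thesis
    unfolding partition_distortion_def max.bounded_iff ereal_minus_le_swap
      diam_part_fibres_le_iff[OF assms(1,3)] alpha_part_fibres_ge_iff[OF assms(3)]
    by auto
qed

section \<open>The upper bound\<close>

lemma le_infdist_add:
  assumes "A \<noteq> {}" "B \<noteq> {}" "\<And>a b. a \<in> A \<Longrightarrow> b \<in> B \<Longrightarrow> c \<le> dist x a + dist y b"
  shows "c \<le> infdist x A + infdist y B"
proof -
  have "c - infdist x A \<le> dist y b" if "b \<in> B" for b
  proof -
    have "c - dist y b \<le> infdist x A"
      unfolding infdist_notempty[OF assms(1)]
      using assms that by (intro cINF_greatest) (auto simp: algebra_simps)
    then show ?thesis by simp
  qed
  then have "c - infdist x A \<le> infdist y B"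
    unfolding infdist_notempty[OF assms(2)] using assms(2) by (intro cINF_greatest) auto
  then show ?thesis by simp
qed

text \<open>
  Join each point \<open>x\<close> to its own vertex \<open>\<phi> x\<close> by a segment of length \<open>r\<close> and let all other distances
  between \<open>S\<close> and \<open>X\<close> be those of shortest paths using one such segment. The shortest path from
  \<open>s\<close> to \<open>x\<close> goes directly to the fibre of \<open>s\<close> and then inside \<open>X\<close> to \<open>x\<close>, or first along an edge of
  the simplex to \<open>\<phi> x\<close>; this gives \<open>r + min l (infdist x (F s))\<close>. The three hypotheses say precisely
  that these segments create no shortcut inside \<open>X\<close> or inside \<open>S\<close>.
\<close>

lemma gh_realized_labelling:
  fixes X :: "'a::metric_space set" and S :: "'b::metric_space set"
  assumes l: "l > 0" and S: "is_simplex l S" and \<phi>: "\<phi> ` X = S" and r: "r > 0"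
    and same: "\<And>x y. x \<in> X \<Longrightarrow> y \<in> X \<Longrightarrow> \<phi> x = \<phi> y \<Longrightarrow> dist x y \<le> 2 * r"
    and diff: "\<And>x y. x \<in> X \<Longrightarrow> y \<in> X \<Longrightarrow> \<phi> x \<noteq> \<phi> y \<Longrightarrow> l - 2 * r \<le> dist x y"
    and all: "\<And>x y. x \<in> X \<Longrightarrow> y \<in> X \<Longrightarrow> dist x y \<le> l + 2 * r"
  shows "\<exists>Z :: ('b + 'a) metric. gh_realized Z S X r"
proof -
  define F where "F s = {x \<in> X. \<phi> x = s}" for s
  have F: "F s \<noteq> {}" if "s \<in> S" for s using that \<phi> by (auto simp: F_def)
  have distS: "dist s t = (if s = t then 0 else l)" if "s \<in> S" "t \<in> S" for s t
    using S that by (auto simp: is_simplex_def)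
  define \<delta> where "\<delta> s x = r + min l (infdist x (F s))" for s x
  have pos: "\<delta> s x \<ge> r" for s x using l by (simp add: \<delta>_def infdist_nonneg)
  \<comment> \<open>No shortcut between two points of \<open>X\<close>: via the fibre of \<open>s\<close> this is the bound on diameters of
    fibres; via an edge of the simplex it is the bound on distances in \<open>X\<close>.\<close>
  have XX: "dist x y \<le> \<delta> s x + \<delta> s y" if "s \<in> S" "x \<in> X" "y \<in> X" for s x y
  proof -
    have "dist x y - 2 * r \<le> infdist x (F s) + infdist y (F s)"
    proof (rule le_infdist_add)
      fix a b assume "a \<in> F s" "b \<in> F s"
      then have "dist a b \<le> 2 * r" by (auto simp: F_def intro: same)
      then show "dist x y - 2 * r \<le> dist x a + dist y b"
        by metric
    qed (use F that in auto)
    then show ?thesis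
      using all[OF that(2,3)] infdist_nonneg[of x "F s"] infdist_nonneg[of y "F s"] l
      by (auto simp: \<delta>_def min_def)
  qed
  \<comment> \<open>No shortcut between two vertices: this is the lower bound on distances between fibres.\<close>
  have SS: "dist s t \<le> \<delta> s x + \<delta> t x" if "s \<in> S" "t \<in> S" "x \<in> X" for s t x
  proof (cases "s = t")
    case True
    then show ?thesis using pos[of t x] r by simp
  next
    case False
    have "l - 2 * r \<le> infdist x (F s) + infdist x (F t)"
    proof (rule le_infdist_add)
      fix a b assume "a \<in> F s" "b \<in> F t"
      then have "l - 2 * r \<le> dist a b" using False by (auto simp: F_def intro: diff)
      then show "l - 2 * r \<le> dist x a + dist x b" by metric
    qed (use F that in auto)
    then show ?thesis
      using False distS that infdist_nonneg[of x "F s"] infdist_nonneg[of x "F t"] r l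
      by (auto simp: \<delta>_def min_def)
  qed
  have SX: "\<delta> s x \<le> dist s t + \<delta> t x" if "s \<in> S" "t \<in> S" for s t x
    using distS[OF that] infdist_nonneg[of x "F t"] l by (auto simp: \<delta>_def min_def)
  have XS: "\<delta> s x \<le> \<delta> s y + dist x y" for s x y
    using infdist_triangle[of x "F s" y] l zero_le_dist[of x y]
    by (auto simp: \<delta>_def min_def simp del: zero_le_dist)
  have SX': "\<delta> s x \<le> \<delta> t x + dist t s" if "s \<in> S" "t \<in> S" for s t x
    using SX[OF that, of x] by (simp add: dist_commute)
  have XS': "\<delta> s x \<le> \<delta> s y + dist y x" and XS'': "\<delta> s x \<le> dist x y + \<delta> s y" for s x y
    using XS[of s x y] by (simp_all add: dist_commute)
  define d :: "'b + 'a \<Rightarrow> 'b + 'a \<Rightarrow> real" where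
    "d u v = (case u of
        Inl s \<Rightarrow> (case v of Inl t \<Rightarrow> dist s t | Inr y \<Rightarrow> \<delta> s y)
      | Inr x \<Rightarrow> (case v of Inl t \<Rightarrow> \<delta> t x | Inr y \<Rightarrow> dist x y))" for u v
  have pos': "0 \<le> \<delta> s x" "\<delta> s x \<noteq> 0" for s x using pos[of s x] r by linarith+
  have "Metric_space (S <+> X) d"
  proof
    fix u v w assume "u \<in> S <+> X" "v \<in> S <+> X" "w \<in> S <+> X"
    then show "d u w \<le> d u v + d v w"
      by (elim PlusE; simp only: d_def sum.case; intro dist_triangle XX SS SX SX' XS XS' XS'')
  qed (auto simp: d_def dist_commute pos' split: sum.splits)
  then interpret Metric_space "S <+> X" d .
  define Z where "Z = metric (S <+> X, d)"
  have ms: "mspace Z = S <+> X" and md: "mdist Z = d"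
    unfolding Z_def by (simp_all add: mspace_metric mdist_metric)
  have "isometric_copy Z (Inl ` S) S" "isometric_copy Z (Inr ` X) X"
    unfolding isometric_copy_def ms md
    by (intro conjI exI[of _ Inl] exI[of _ Inr]; force simp: d_def bij_betw_def)+
  moreover have "hausdorff_dist Z (Inl ` S) (Inr ` X) \<le> ereal r"
  proof -
    have self: "\<delta> (\<phi> x) x = r" if "x \<in> X" for x
      using that l by (simp add: \<delta>_def F_def)
    have "(INF b\<in>Inr ` X. ereal (d a b)) \<le> ereal r" if a: "a \<in> Inl ` S" for a
    proof -
      obtain x where "x \<in> X" "a = Inl (\<phi> x)" using a unfolding \<phi>[symmetric] by auto
      then show ?thesis by (intro INF_lower2[of "Inr x"]) (auto simp: d_def self)
    qed
    moreover have "(INF a\<in>Inl ` S. ereal (d a b)) \<le> ereal r" if b: "b \<in> Inr ` X" for b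
    proof -
      obtain x where "x \<in> X" "b = Inr x" using b by auto
      then show ?thesis using \<phi> by (intro INF_lower2[of "Inl (\<phi> x)"]) (auto simp: d_def self)
    qed
    ultimately show ?thesis
      unfolding hausdorff_dist_def md by (intro max.boundedI SUP_least)
  qed
  ultimately show ?thesis unfolding gh_realized_def by blast
qed

section \<open>The lower bound\<close>

text \<open>
  Vertices and points whose images are closer than \<open>r'\<close> form a correspondence \<open>R\<close> of distortion
  at most \<open>2 * r'\<close>. The radius is enlarged from \<open>r\<close> to \<open>r'\<close> because the Hausdorff
  distance is built from infima that need not be attained.
\<close>

lemma labelling_of_gh_realized:
  fixes X :: "'a::metric_space set" and S :: "'b::metric_space set" and Z :: "'c metric"
  assumes l: "l > 0" and S: "is_simplex l S" and card: "S \<lesssim> X"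
    and real: "gh_realized Z S X r" and r': "r < r'"
  obtains \<phi> where "\<phi> ` X = S"
    "\<And>x y. x \<in> X \<Longrightarrow> y \<in> X \<Longrightarrow> \<phi> x = \<phi> y \<Longrightarrow> dist x y \<le> 2 * r'"
    "\<And>x y. x \<in> X \<Longrightarrow> y \<in> X \<Longrightarrow> \<phi> x \<noteq> \<phi> y \<Longrightarrow> l - 2 * r' \<le> dist x y"
    "\<And>x y. x \<in> X \<Longrightarrow> y \<in> X \<Longrightarrow> dist x y \<le> l + 2 * r'"
proof -
  obtain A B f g where A: "A \<subseteq> mspace Z" "bij_betw f S A"
      "\<And>s t. s \<in> S \<Longrightarrow> t \<in> S \<Longrightarrow> mdist Z (f s) (f t) = dist s t"
    and B: "B \<subseteq> mspace Z" "bij_betw g X B"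
      "\<And>x y. x \<in> X \<Longrightarrow> y \<in> X \<Longrightarrow> mdist Z (g x) (g y) = dist x y"
    and H: "hausdorff_dist Z A B \<le> ereal r"
    using real unfolding gh_realized_def isometric_copy_def by blast
  have fA: "f ` S = A" and gB: "g ` X = B"
    using A B by (auto simp: bij_betw_def)
  define R where "R s x \<longleftrightarrow> mdist Z (f s) (g x) < r'" for s x
  have inZ: "f s \<in> mspace Z" "g x \<in> mspace Z" if "s \<in> S" "x \<in> X" for s x
    using that A B fA gB by auto
  have H1: "(INF b\<in>B. ereal (mdist Z a b)) < ereal r'" if "a \<in> A" for a
  proof -
    have "(INF b\<in>B. ereal (mdist Z a b)) \<le> ereal r"
      using H that unfolding hausdorff_dist_def by (auto simp: SUP_le_iff)
    then show ?thesis using r' by (simp add: le_less_trans)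
  qed
  have H2: "(INF a\<in>A. ereal (mdist Z a b)) < ereal r'" if "b \<in> B" for b
  proof -
    have "(INF a\<in>A. ereal (mdist Z a b)) \<le> ereal r"
      using H that unfolding hausdorff_dist_def by (auto simp: SUP_le_iff)
    then show ?thesis using r' by (simp add: le_less_trans)
  qed
  have Rl: "\<exists>x\<in>X. R s x" if "s \<in> S" for s
    using H1[of "f s"] that fA gB by (auto simp: INF_less_iff R_def)
  have Rr: "\<exists>s\<in>S. R s x" if "x \<in> X" for x
    using H2[of "g x"] that fA gB by (auto simp: INF_less_iff R_def)
  have dis: "dist x y < dist s t + 2 * r'" "dist s t < dist x y + 2 * r'"
    if "s \<in> S" "t \<in> S" "x \<in> X" "y \<in> X" "R s x" "R t y" for s t x y
  proof -
    have "mdist Z (g x) (g y) \<le> mdist Z (f s) (g x) + mdist Z (f s) (f t) + mdist Z (f t) (g y)"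
      using inZ that
      by (smt (verit) mdist_commute mdist_triangle)
    then show "dist x y < dist s t + 2 * r'" using that A(3) B(3) by (simp add: R_def)
    have "mdist Z (f s) (f t) \<le> mdist Z (f s) (g x) + mdist Z (g x) (g y) + mdist Z (f t) (g y)"
      using inZ that
      by (smt (verit) mdist_commute mdist_triangle)
    then show "dist s t < dist x y + 2 * r'" using that A(3) B(3) by (simp add: R_def)
  qed
  have distS: "dist s t = (if s = t then 0 else l)" if "s \<in> S" "t \<in> S" for s t
    using S that by (auto simp: is_simplex_def)
  obtain \<psi> where \<psi>: "\<And>x. x \<in> X \<Longrightarrow> \<psi> x \<in> S \<and> R (\<psi> x) x"
    using Rr by metis
  have same: "dist x y \<le> 2 * r'" if "x \<in> X" "y \<in> X" "\<psi> x = \<psi> y" for x y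
    using dis(1)[of "\<psi> x" "\<psi> y" x y] \<psi>[OF that(1)] \<psi>[OF that(2)] that by simp
  have all: "dist x y \<le> l + 2 * r'" if "x \<in> X" "y \<in> X" for x y
    using dis(1)[of "\<psi> x" "\<psi> y" x y] \<psi>[OF that(1)] \<psi>[OF that(2)] that l
    by (auto simp: distS split: if_splits)
  show thesis
  proof (cases "2 * r' \<le> l")
    case True
    \<comment> \<open>Two different vertices related to one point would be at distance less than \<open>2 * r' \<le> l\<close>.\<close>
    have uniq: "s = t" if "s \<in> S" "t \<in> S" "x \<in> X" "R s x" "R t x" for s t x
      using dis(2)[of s t x x] that True by (auto simp: distS split: if_splits)
    have "\<psi> ` X = S"
      using Rl \<psi> uniq by (auto simp: image_iff) metis
    moreover have "l - 2 * r' \<le> dist x y" if "x \<in> X" "y \<in> X" "\<psi> x \<noteq> \<psi> y" for x y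
      using dis(2)[of "\<psi> x" "\<psi> y" x y] \<psi>[OF that(1)] \<psi>[OF that(2)] that
      by (auto simp: distS split: if_splits)
    ultimately show ?thesis using that same all by blast
  next
    case False
    \<comment> \<open>Here \<open>l - 2 * r'\<close> is negative, so only the other two bounds matter, and both survive refinement.\<close>
    have "\<psi> ` X \<subseteq> S" using \<psi> by auto
    then obtain \<phi> where \<phi>: "\<phi> ` X = S"
        "\<And>x y. x \<in> X \<Longrightarrow> y \<in> X \<Longrightarrow> \<phi> x = \<phi> y \<Longrightarrow> \<psi> x = \<psi> y"
      using refine_to_surjective_labelling card by metis
    have "l - 2 * r' \<le> dist x y" for x y :: 'a
      using False zero_le_dist[of x y] by linarith
    then show ?thesis using that \<phi> same all by blast
  qed
qed

section \<open>The distance to a simplex\<close>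

text \<open>
  A metric on the disjoint union needs \<open>r > 0\<close> even when the bound is \<open>0\<close>, and a labelling is only
  obtained at a radius larger than the realized one; hence both inequalities are proved up to an arbitrary \<open>e > 0\<close>.
\<close>

theorem gh_dist_simplex:
  fixes X :: "'a::metric_space set" and S :: "'b::metric_space set"
  assumes X: "X \<noteq> {}" "bounded X" and l: "l > 0" and S: "is_simplex l S" and card: "S \<lesssim> X"
  shows "2 * gh_dist S X = (INF D\<in>partitions_card S X. partition_distortion l X D)"
    (is "_ = ?I")
proof (rule antisym)
  show "2 * gh_dist S X \<le> ?I"
  proof (rule INF_greatest)
    fix D assume "D \<in> partitions_card S X"
    then obtain \<phi> where \<phi>: "\<phi> ` X = S" and D: "D = fibres \<phi> S X"
      by (auto simp: partitions_card_eq_fibres)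
    show "2 * gh_dist S X \<le> partition_distortion l X D"
    proof (rule ereal_le_real)
      fix c assume "partition_distortion l X D \<le> ereal c"
      then have c: "\<forall>x\<in>X. \<forall>y\<in>X. (\<phi> x = \<phi> y \<longrightarrow> dist x y \<le> c) \<and>
          (\<phi> x \<noteq> \<phi> y \<longrightarrow> l - c \<le> dist x y) \<and> dist x y \<le> l + c"
        unfolding D partition_distortion_fibres_le_iff[OF X(2,1) \<phi>] .
      have "c \<ge> 0" using c X(1) by force
      have "gh_dist S X \<le> ereal (c / 2)"
      proof (rule ereal_le_epsilon2)
        fix e :: real assume "e > 0"
        have "\<exists>Z :: ('b + 'a) metric. gh_realized Z S X (c / 2 + e)"
        proof (rule gh_realized_labelling[OF l S \<phi>])
          fix x y assume "x \<in> X" "y \<in> X"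
          then have *: "\<phi> x = \<phi> y \<longrightarrow> dist x y \<le> c" "\<phi> x \<noteq> \<phi> y \<longrightarrow> l - c \<le> dist x y"
            "dist x y \<le> l + c" using c by auto
          show "\<phi> x = \<phi> y \<Longrightarrow> dist x y \<le> 2 * (c / 2 + e)" using * \<open>e > 0\<close> by simp
          show "\<phi> x \<noteq> \<phi> y \<Longrightarrow> l - 2 * (c / 2 + e) \<le> dist x y" using * \<open>e > 0\<close> by simp
          show "dist x y \<le> l + 2 * (c / 2 + e)" using * \<open>e > 0\<close> by simp
        qed (use \<open>c \<ge> 0\<close> \<open>e > 0\<close> in simp)
        then show "gh_dist S X \<le> ereal (c / 2) + ereal e"
          unfolding gh_dist_def by (auto intro!: Inf_lower)
      qed
      then show "2 * gh_dist S X \<le> ereal c"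
        by (cases "gh_dist S X") auto
    qed
  qed
next
  have key: "?I \<le> ereal (2 * r)" if "gh_realized Z S X r" for Z :: "('b + 'a) metric" and r
  proof (rule ereal_le_epsilon2)
    fix e :: real assume "e > 0"
    then have "r < r + e / 2" by simp
    from labelling_of_gh_realized[OF l S card that this]
    obtain \<phi> where \<phi>: "\<phi> ` X = S"
      "\<forall>x\<in>X. \<forall>y\<in>X. (\<phi> x = \<phi> y \<longrightarrow> dist x y \<le> 2 * (r + e / 2)) \<and>
         (\<phi> x \<noteq> \<phi> y \<longrightarrow> l - 2 * (r + e / 2) \<le> dist x y) \<and> dist x y \<le> l + 2 * (r + e / 2)"
      by metis
    then have "partition_distortion l X (fibres \<phi> S X) \<le> ereal (2 * (r + e / 2))"
      unfolding partition_distortion_fibres_le_iff[OF X(2,1) \<phi>(1)] by blast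
    moreover have "fibres \<phi> S X \<in> partitions_card S X"
      using \<phi>(1) by (auto simp: partitions_card_eq_fibres)
    ultimately show "?I \<le> ereal (2 * r) + ereal e"
      by (auto intro!: INF_lower2 simp: algebra_simps)
  qed
  show "?I \<le> 2 * gh_dist S X"
  proof (cases ?I)
    case (real i)
    have "ereal (i / 2) \<le> gh_dist S X"
      unfolding gh_dist_def using key real by (fastforce intro!: Inf_greatest)
    then show ?thesis unfolding real by (cases "gh_dist S X") auto
  next
    case PInf
    have "gh_dist S X = \<infinity>"
      unfolding gh_dist_def Inf_eq_PInfty using key PInf by fastforce
    then show ?thesis by simp
  qed simp
qed

section \<open>The three ranges of the edge length\<close>

theorem corollary2p17:
  fixes X :: "'a::metric_space set" and S :: "'b::metric_space set" and l :: real
  assumes "X \<noteq> {}" and "bounded X"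
    and "l > 0" and "is_simplex l S" and "S \<lesssim> X"
    and "ereal (diameter X) - alpha_minus S X \<le> 2 * d_minus S X"
  shows "(ereal l \<le> alpha_minus S X + d_minus S X \<longrightarrow>
            2 * gh_dist S X = max (ereal (diameter X) - ereal l) (d_minus S X))
       \<and> (alpha_minus S X + d_minus S X \<le> ereal l \<and> ereal l \<le> alpha_plus S X + d_plus S X \<longrightarrow>
            max (ereal l - alpha_plus S X) (d_minus S X) \<le> 2 * gh_dist S X
          \<and> 2 * gh_dist S X \<le> min (ereal l - alpha_minus S X) (d_plus S X))
       \<and> (ereal l \<ge> alpha_plus S X + d_plus S X \<longrightarrow>
            2 * gh_dist S X = ereal l - alpha_plus S X)"
proof -
  let ?P = "partitions_card S X"
  define am ap dm dp where "am = alpha_minus S X" and "ap = alpha_plus S X"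
    and "dm = d_minus S X" and "dp = d_plus S X"
  note defs = am_def ap_def dm_def dp_def
  have gh: "2 * gh_dist S X = (INF D\<in>?P. partition_distortion l X D)"
    using assms(1-5) by (rule gh_dist_simplex)
  obtain s where "s \<in> S" using assms(4) by (auto simp: is_simplex_def)
  then have "(\<lambda>_. s) ` X \<subseteq> S" by auto
  then obtain \<phi> where "\<phi> ` X = S"
    using refine_to_surjective_labelling[of "\<lambda>_. s" X S] assms(5) by metis
  then have ne: "?P \<noteq> {}" by (auto simp: partitions_card_eq_fibres)
  have diam: "0 \<le> diam_part D" "diam_part D \<le> ereal (diameter X)" if "D \<in> ?P" for D
  proof -
    obtain \<phi> where \<phi>: "\<phi> ` X = S" and D: "D = fibres \<phi> S X"
      using \<open>D \<in> ?P\<close> by (auto simp: partitions_card_eq_fibres)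
    have "bounded {x \<in> X. \<phi> x = s}"
      using assms(2) by (rule bounded_subset) auto
    then show "0 \<le> diam_part D"
      unfolding D diam_part_def fibres_def
      using \<open>s \<in> S\<close> by (auto intro!: SUP_upper2[of s] diameter_ge_0 simp: image_image)
    show "diam_part D \<le> ereal (diameter X)"
      unfolding D diam_part_fibres_le_iff[OF assms(2) \<phi>]
      using diameter_bounded_bound[OF assms(2)] by blast
  qed
  have alpha: "0 \<le> alpha_part D" for D :: "'a set set"
    unfolding alpha_part_def by (auto intro!: Inf_greatest)
  have dmD: "dm \<le> diam_part D" "diam_part D \<le> dp" "am \<le> alpha_part D" "alpha_part D \<le> ap"
    if "D \<in> ?P" for D
    unfolding defs d_minus_def d_plus_def alpha_minus_def alpha_plus_def
    using that by (auto intro: INF_lower SUP_upper)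
  obtain D0 where D0: "D0 \<in> ?P" using ne by auto
  have le: "dm \<le> dp" "am \<le> ap" using dmD[OF D0] by auto
  have am0: "0 \<le> am" unfolding defs alpha_minus_def by (intro INF_greatest alpha)
  have dm0: "0 \<le> dm" unfolding defs d_minus_def by (intro INF_greatest diam)
  have dp1: "dp \<le> ereal (diameter X)" unfolding defs d_plus_def by (intro SUP_least diam)
  \<comment> \<open>The diameters are finite, whereas \<open>am\<close> and \<open>ap\<close> are infinite if the simplex is a single
    point. Then only the first range is possible, and the case distinctions on \<open>am\<close> and \<open>ap\<close> below
    settle this.\<close>
  obtain m p where mp: "dm = ereal m" "dp = ereal p"
    using dm0 dp1 le by (cases dm; cases dp) auto
  have distD: "partition_distortion l X D =
     max (diam_part D) (max (ereal l - alpha_part D) (ereal (diameter X) - ereal l))" for D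
    by (simp add: partition_distortion_def)
  have INF_max: "(INF D\<in>?P. max (diam_part D) c) = max dm c" for c
    unfolding defs d_minus_def sup_max[symmetric]
    by (simp only: sup.commute[of _ c] sup_INF[symmetric])
  have part1: "2 * gh_dist S X = max (ereal (diameter X) - ereal l) dm" if "ereal l \<le> am + dm"
  proof -
    have "partition_distortion l X D = max (diam_part D) (ereal (diameter X) - ereal l)"
      if "D \<in> ?P" for D
    proof -
      have "ereal l \<le> alpha_part D + diam_part D"
        using \<open>ereal l \<le> am + dm\<close> dmD[OF that] by (meson add_mono order_trans)
      then have "ereal l - alpha_part D \<le> diam_part D"
        using diam[OF that] alpha[of D] by (cases "alpha_part D"; cases "diam_part D") auto
      then show ?thesis unfolding distD by (simp add: max.absorb1 max.assoc[symmetric])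
    qed
    then show ?thesis unfolding gh by (simp add: INF_max max.commute cong: INF_cong)
  qed
  have red: "partition_distortion l X D = max (diam_part D) (ereal l - alpha_part D)"
    if "am + dm \<le> ereal l" "D \<in> ?P" for D
  proof -
    have "ereal (diameter X) - ereal l \<le> dm"
      using assms(6) that(1) am0 unfolding defs[symmetric] mp by (cases am) auto
    then have "ereal (diameter X) - ereal l \<le> diam_part D"
      using dmD[OF that(2)] by simp
    then show ?thesis unfolding distD by (auto simp: max_def)
  qed
  have part2: "max (ereal l - ap) dm \<le> 2 * gh_dist S X"
    "2 * gh_dist S X \<le> min (ereal l - am) dp"
    if A: "am + dm \<le> ereal l" and B: "ereal l \<le> ap + dp"
  proof -
    show "max (ereal l - ap) dm \<le> 2 * gh_dist S X"
      unfolding gh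
    proof (rule INF_greatest)
      fix D assume D: "D \<in> ?P"
      show "max (ereal l - ap) dm \<le> partition_distortion l X D"
        unfolding red[OF A D] using dmD[OF D] by (auto intro: max.coboundedI1 max.coboundedI2 ereal_minus_mono)
    qed
    have "2 * gh_dist S X \<le> (INF D\<in>?P. max (diam_part D) (ereal l - am))"
      unfolding gh
    proof (rule INF_mono, rule bexI)
      fix D assume D: "D \<in> ?P"
      show "partition_distortion l X D \<le> max (diam_part D) (ereal l - am)"
        unfolding red[OF A D] using dmD[OF D] by (intro max.mono ereal_minus_mono) auto
    qed simp
    also have "\<dots> = ereal l - am"
      using A am0 unfolding INF_max mp by (cases am) auto
    finally have 1: "2 * gh_dist S X \<le> ereal l - am" .
    \<comment> \<open>A partition that nearly attains \<open>ap\<close> has \<open>l - alpha_part D\<close> barely above \<open>l - ap \<le> dp\<close>, and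
      its diameter is at most \<open>dp\<close> as for every partition.\<close>
    have 2: "2 * gh_dist S X \<le> dp"
      unfolding gh
    proof (rule dense_ge)
      fix y assume y: "dp < y"
      have "ereal l - ap < y"
        using B y le am0 unfolding mp by (cases ap; cases y) auto
      then have "(INF D\<in>?P. ereal l - alpha_part D) < y"
        unfolding defs alpha_plus_def using ne by (simp add: INF_ereal_minus_right)
      then obtain D where D: "D \<in> ?P" "ereal l - alpha_part D < y"
        by (auto simp: INF_less_iff)
      then have "partition_distortion l X D \<le> y"
        unfolding red[OF A D(1)] using dmD[OF D(1)] y by auto
      then show "(INF D\<in>?P. partition_distortion l X D) \<le> y"
        using D(1) by (rule INF_lower2[rotated])
    qed
    show "2 * gh_dist S X \<le> min (ereal l - am) dp" using 1 2 by simp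
  qed
  have part3: "2 * gh_dist S X = ereal l - ap" if C: "ap + dp \<le> ereal l"
  proof -
    have A: "am + dm \<le> ereal l" using C le by (meson add_mono order_trans)
    have "partition_distortion l X D = ereal l - alpha_part D" if "D \<in> ?P" for D
    proof -
      have "dp \<le> ereal l - ap"
        using C le am0 unfolding mp by (cases ap) auto
      also have "\<dots> \<le> ereal l - alpha_part D"
        using dmD[OF that] by (intro ereal_minus_mono) auto
      finally show ?thesis
        unfolding red[OF A that] using dmD[OF that] by (simp add: max.absorb2)
    qed
    then show ?thesis
      unfolding gh defs alpha_plus_def using ne by (simp add: INF_ereal_minus_right cong: INF_cong)
  qed
  show ?thesis using part1 part2 part3 unfolding defs by blast
qed

end
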